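(* For $n\in[N]$ let $\mathbf{S}_n = \mathbf{\Omega}_n \mathbf{D}_n \in \mathbb{R}^{m \times I_n}$, where $\mathbf{\Omega}_n \in \mathbb{R}^{m \times I_n}$ and $\mathbf{D}_n \in \mathbb{R}^{I_n \times I_n}$ are the matrices defined from the hash maps $H_n:[I_n]\to[m]$ and $S_n:[I_n]\to\{-1,1\}$, respectively. Let $\mathbf{T} \in \mathbb{R}^{m \times \prod_{j=1}^N I_j}$ be the TensorSketch defined from the same hash maps $H_1,\dots,H_N,S_1,\dots,S_N$, and let $\mathcal{P} = \mathcal{A}^{(1)}\boxtimes_2 \mathcal{A}^{(2)}\boxtimes_2 \cdots \boxtimes_2 \mathcal{A}^{(N)}$ with $\mathcal{A}^{(n)} \in \mathbb{R}^{R_n \times I_n \times R_{n+1}}$ for $n \in [N]$. Then $$\mathcal{P} \times_2 \mathbf{T} = \mathrm{FFT}^{-1}\Big( \mathrm{FFT}\big(\mathcal{A}^{(1)} \times_2 \mathbf{S}_{1}, [\,], 2\big)\circledast_2 \mathrm{FFT}\big(\mathcal{A}^{(2)} \times_2 \mathbf{S}_{2}, [\,], 2\big)\circledast_2\cdots\circledast_2 \mathrm{FFT}\big(\mathcal{A}^{(N)} \times_2 \mathbf{S}_{N}, [\,], 2\big), [\,], 2 \Big),$$ where $\boxtimes_2$ is the mode-2 subchain product, $\circledast_2$ the mode-2 slices-Hadamard product, $\times_2$ the mode-2 product, and $\mathrm{FFT}(\cdot,[\,],2)$, $\mathrm{FFT}^{-1}(\cdot,[\,],2)$ are the discrete Fourier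 transform along the second mode and its inverse.
   Context: All dimensions $N,m,I_1,\dots,I_N,R_1,\dots,R_{N+1}$ are positive integers, and $[I]=\{1,\dots,I\}$. Multi-index (little-endian convention): for $i_1\in[I_1],\dots,i_N\in[I_N]$, $\overline{i_1 i_2\cdots i_N} = i_1+(i_2-1)I_1+(i_3-1)I_1I_2+\cdots+(i_N-1)I_1\cdots I_{N-1}\in[\prod_{j=1}^N I_j]$. Lateral slice: for a 3-order tensor $\mathcal{X}$ of size $P\times J\times Q$ and $j\in[J]$, the $j$-th lateral slice is the $P\times Q$ matrix $\mathcal{X}(j)=\mathcal{X}(:,j,:)$. Mode-2 product: for $\mathcal{X}$ of size $P\times J\times Q$ and a matrix $\mathbf{U}$ of size $R\times J$, $\mathcal{X}\times_2\mathbf{U}$ has size $P\times R\times Q$ and $(\mathcal{X}\times_2\mathbf{U})(p,r,q)=\sum_{j=1}^{J}\mathcal{X}(p,j,q)\,\mathbf{U}(r,j)$. Mode-2 subchain product: for $\mathcal{A}$ of size $I_1\times J_1\times K$ and $\mathcal{B}$ of size $K\times J_2\times I_2$, $\mathcal{A}\boxtimes_2\mathcal{B}$ is the tensor of size $I_1\times J_1J_2\times I_2$ with lateral slices $(\mathcal{A}\boxtimes_2\mathcal{B})(\overline{j_1j_2})=\mathcal{A}(j_1)\,\mathcal{B}(j_2)$ (ordinary matrix product). This product is associative; $\mathcal{P}$ in the claim has size $R_1\times\prod_{j=1}^N I_j\times R_{N+1}$ and lateral slices $\mathcal{P}(\overline{i_1\cdots i_N})=\mathcal{A}^{(1)}(i_1)\cdots\mathcal{A}^{(N)}(i_N)$.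 Mode-2 slices-Hadamard product: for (real or complex) tensors $\mathcal{X}$ of size $P\times J\times K$ and $\mathcal{Y}$ of size $K\times J\times Q$, $\mathcal{X}\circledast_2\mathcal{Y}$ is the tensor of size $P\times J\times Q$ with lateral slices $(\mathcal{X}\circledast_2\mathcal{Y})(j)=\mathcal{X}(j)\,\mathcal{Y}(j)$ (ordinary matrix product) for $j\in[J]$. This product is associative. Hash maps and sketches: for each $n\in[N]$, $H_n:[I_n]\to[m]$ is a 3-wise independent hash map and $S_n:[I_n]\to\{-1,1\}$ is a 4-wise independent hash map (a hash map is $k$-wise independent if its values at any designated $k$ keys are independent random variables). The identity in the claim is between quantities built from the same realization of these maps. Define $\mathbf{\Omega}_n\in\mathbb{R}^{m\times I_n}$ by $\mathbf{\Omega}_n(j,i)=1$ if $j=H_n(i)$ and $0$ otherwise, and $\mathbf{D}_n\in\mathbb{R}^{I_n\times I_n}$ as the diagonal matrix with $\mathbf{D}_n(i,i)=S_n(i)$. Define on $[I_1]\times\cdots\times[I_N]$ $$H(i_1,\dots,i_N)=\Big(\sum_{n=1}^N (H_n(i_n)-1)\ \bmod\ m\Big)+1\in[m],\qquad S(i_1,\dots,i_N)=\prod_{n=1}^N S_n(i_n)\in\{-1,1\},$$ where the mod is applied to the whole sum, and for $i=\overline{i_1\cdots i_N}$ write $H(i)=H(i_1,\dots,i_N)$, $S(i)=S(i_1,\dots,i_N)$. The TensorSketch is $\mathbf{T}=\mathbf{\Omega}\mathbf{D}\in\mathbb{R}^{m\times\prod_{j=1}^N I_j}$, where $\mathbf{\Omega}\in\mathbb{R}^{m\times\prod_j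 I_j}$ has $\mathbf{\Omega}(j,i)=1$ if $j=H(i)$ and $0$ otherwise, and $\mathbf{D}$ is the diagonal matrix of order $\prod_{j=1}^N I_j$ with $\mathbf{D}(i,i)=S(i)$. Fourier transform (MATLAB notation): for $\mathcal{X}$ of size $P\times m\times Q$, $\mathrm{FFT}(\mathcal{X},[\,],2)$ is the complex tensor of the same size obtained by applying the unnormalized length-$m$ discrete Fourier transform to each fiber $\mathcal{X}(p,:,q)$, i.e. $\mathrm{FFT}(\mathcal{X},[\,],2)(p,k,q)=\sum_{j=1}^m \mathcal{X}(p,j,q)\,e^{-2\pi \mathrm{i}(j-1)(k-1)/m}$; $\mathrm{FFT}^{-1}(\cdot,[\,],2)$ is the inverse of this map. *)

theory Defs
  imports
    "HOL-Probability.Probability"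
    "Jordan_Normal_Form.Matrix"
begin

text \<open>
  All index ranges are 0-based, as in \<^typ>\<open>'a mat\<close>: the set \<open>[I] = {1,\<dots>,I}\<close> becomes
  \<open>{..<I}\<close>, for tensor and matrix entries, for keys and values of the hash maps, and for the
  numbering of the factors. An index \<open>i\<close> here is the index \<open>i + 1\<close> of the 1-based convention,
  which absorbs the shifts by one in the multi-index, in the combined hash map and in the
  Fourier exponent.
\<close>

section \<open>Tensors of order three\<close>

text \<open>The entry function is \<^const>\<open>undefined\<close> outside the index box, so that two tensors are
  equal iff their sizes and all their entries agree.\<close>

typedef 'a tensor3 =
  "{(P, J, Q, f). f \<in> extensional ({..<P} \<times> {..<J} \<times> {..<Q})}
     :: (nat \<times> nat \<times> nat \<times> (nat \<times> nat \<times> nat \<Rightarrow> 'a)) set"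
  by (rule exI[of _ "(0, 0, 0, \<lambda>_. undefined)"]) (auto simp: extensional_def)

setup_lifting type_definition_tensor3

lift_definition tensor3 ::
    "nat \<Rightarrow> nat \<Rightarrow> nat \<Rightarrow> (nat \<Rightarrow> nat \<Rightarrow> nat \<Rightarrow> 'a) \<Rightarrow> 'a tensor3"
  is "\<lambda>P J Q f. (P, J, Q, restrict (\<lambda>(p, j, q). f p j q) ({..<P} \<times> {..<J} \<times> {..<Q}))"
  by auto

lift_definition dim1 :: "'a tensor3 \<Rightarrow> nat" is "\<lambda>(P, J, Q, f). P" .
lift_definition dim2 :: "'a tensor3 \<Rightarrow> nat" is "\<lambda>(P, J, Q, f). J" .
lift_definition dim3 :: "'a tensor3 \<Rightarrow> nat" is "\<lambda>(P, J, Q, f). Q" .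
lift_definition entry :: "'a tensor3 \<Rightarrow> nat \<Rightarrow> nat \<Rightarrow> nat \<Rightarrow> 'a"
  is "\<lambda>(P, J, Q, f) p j q. f (p, j, q)" .

lemma dim_tensor3 [simp]:
  "dim1 (tensor3 P J Q f) = P" "dim2 (tensor3 P J Q f) = J" "dim3 (tensor3 P J Q f) = Q"
  by (transfer; simp)+

lemma entry_tensor3 [simp]:
  "p < P \<Longrightarrow> j < J \<Longrightarrow> q < Q \<Longrightarrow> entry (tensor3 P J Q f) p j q = f p j q"
  by transfer simp

lemma tensor3_eqI:
  assumes "dim1 X = dim1 Y" "dim2 X = dim2 Y" "dim3 X = dim3 Y"
    and "\<And>p j q. p < dim1 Y \<Longrightarrow> j < dim2 Y \<Longrightarrow> q < dim3 Y \<Longrightarrow> entry X p j q = entry Y p j q"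
  shows "X = Y"
  using assms by transfer (auto simp: extensional_def fun_eq_iff, metis)

definition carrier_tensor3 :: "nat \<Rightarrow> nat \<Rightarrow> nat \<Rightarrow> 'a tensor3 set" where
  "carrier_tensor3 P J Q = {X. dim1 X = P \<and> dim2 X = J \<and> dim3 X = Q}"

definition map_tensor3 :: "('a \<Rightarrow> 'b) \<Rightarrow> 'a tensor3 \<Rightarrow> 'b tensor3" where
  "map_tensor3 g X = tensor3 (dim1 X) (dim2 X) (dim3 X) (\<lambda>p j q. g (entry X p j q))"

definition lateral_slice :: "'a tensor3 \<Rightarrow> nat \<Rightarrow> 'a mat" where
  "lateral_slice X j = Matrix.mat (dim1 X) (dim3 X) (\<lambda>(p, q). entry X p j q)"

definition tensor_of_slices :: "nat \<Rightarrow> nat \<Rightarrow> nat \<Rightarrow> (nat \<Rightarrow> 'a mat) \<Rightarrow> 'a tensor3" where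
  "tensor_of_slices P J Q F = tensor3 P J Q (\<lambda>p j q. F j $$ (p, q))"

lemma lateral_slice_tensor_of_slices:
  assumes "j < J" "F j \<in> carrier_mat P Q"
  shows "lateral_slice (tensor_of_slices P J Q F) j = F j"
  using assms by (intro eq_matI) (auto simp: lateral_slice_def tensor_of_slices_def)

section \<open>Products of tensors\<close>

definition mode2_prod :: "'a::comm_semiring_0 tensor3 \<Rightarrow> 'a mat \<Rightarrow> 'a tensor3"
    (infixl "\<times>\<^sub>2" 71) where
  "X \<times>\<^sub>2 U = tensor3 (dim1 X) (dim_row U) (dim3 X)
     (\<lambda>p r q. \<Sum>j<dim2 X. entry X p j q * U $$ (r, j))"

text \<open>Slice \<open>j\<close> belongs to the pair \<open>(j\<^sub>1, j\<^sub>2)\<close> with \<open>j = j\<^sub>1 + j\<^sub>2 J\<^sub>1\<close>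
  (little-endian multi-index); see \<open>lateral_slice_subchain_prod\<close>.\<close>

definition subchain_prod :: "'a::comm_semiring_0 tensor3 \<Rightarrow> 'a tensor3 \<Rightarrow> 'a tensor3"
    (infixl "\<boxtimes>\<^sub>2" 72) where
  "A \<boxtimes>\<^sub>2 B = tensor_of_slices (dim1 A) (dim2 A * dim2 B) (dim3 B)
     (\<lambda>j. lateral_slice A (j mod dim2 A) * lateral_slice B (j div dim2 A))"

definition slices_hadamard_prod :: "'a::comm_semiring_0 tensor3 \<Rightarrow> 'a tensor3 \<Rightarrow> 'a tensor3"
    (infixl "\<circledast>\<^sub>2" 72) where
  "X \<circledast>\<^sub>2 Y = tensor_of_slices (dim1 X) (dim2 X) (dim3 Y)
     (\<lambda>j. lateral_slice X j * lateral_slice Y j)"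

text \<open>The product of \<open>X 0, \<dots>, X (N - 1)\<close> for \<open>N \<ge> 1\<close>. Both products above are associative on
  tensors of matching sizes, so that the bracketing (here to the left) is immaterial.\<close>

definition chain_prod :: "('b \<Rightarrow> 'b \<Rightarrow> 'b) \<Rightarrow> (nat \<Rightarrow> 'b) \<Rightarrow> nat \<Rightarrow> 'b" where
  "chain_prod f X N = foldl f (X 0) (map X [1..<N])"

lemma lateral_slice_subchain_prod:
  assumes "j1 < dim2 A" "j2 < dim2 B"
  shows "lateral_slice (A \<boxtimes>\<^sub>2 B) (j1 + j2 * dim2 A) = lateral_slice A j1 * lateral_slice B j2"
proof -
  have "j1 + j2 * dim2 A < dim2 A + j2 * dim2 A" using assms by simp
  also have "\<dots> = Suc j2 * dim2 A" by simp
  also have "\<dots> \<le> dim2 B * dim2 A" using assms by (intro mult_right_mono) auto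
  finally have lt: "j1 + j2 * dim2 A < dim2 A * dim2 B" by (simp add: mult.commute)
  show ?thesis
    unfolding subchain_prod_def
    by (subst lateral_slice_tensor_of_slices[OF lt])
       (use assms in \<open>auto simp: lateral_slice_def intro!: carrier_matI\<close>)
qed

section \<open>Multi-indices\<close>

definition multi_index :: "(nat \<Rightarrow> nat) \<Rightarrow> nat \<Rightarrow> (nat \<Rightarrow> nat) \<Rightarrow> nat" where
  "multi_index I N i = (\<Sum>n<N. i n * (\<Prod>k<n. I k))"

text \<open>Component \<open>n\<close> of the tuple whose multi-index is \<open>l\<close>.\<close>

definition multi_digit :: "(nat \<Rightarrow> nat) \<Rightarrow> nat \<Rightarrow> nat \<Rightarrow> nat" where
  "multi_digit I l n = (l div (\<Prod>k<n. I k)) mod I n"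

lemma multi_index_less:
  assumes "\<And>n. n < N \<Longrightarrow> i n < I n"
  shows "multi_index I N i < (\<Prod>n<N. I n)"
  using assms
proof (induction N)
  case 0
  then show ?case by (simp add: multi_index_def)
next
  case (Suc N)
  have "multi_index I (Suc N) i = multi_index I N i + i N * (\<Prod>k<N. I k)"
    by (simp add: multi_index_def)
  also have "\<dots> < (\<Prod>k<N. I k) + i N * (\<Prod>k<N. I k)" using Suc by simp
  also have "\<dots> = Suc (i N) * (\<Prod>k<N. I k)" by simp
  also have "\<dots> \<le> I N * (\<Prod>k<N. I k)" using Suc.prems by (intro mult_right_mono) (auto simp: Suc_le_eq)
  finally show ?case by (simp add: mult.commute)
qed

lemma multi_digit_multi_index:
  assumes "\<And>n. n < N \<Longrightarrow> i n < I n" "n < N"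
  shows "multi_digit I (multi_index I N i) n = i n"
  using assms
proof (induction N)
  case 0
  then show ?case by simp
next
  case (Suc N)
  define Q where "Q = (\<Prod>k<N. I k)"
  have eq: "multi_index I (Suc N) i = multi_index I N i + i N * Q"
    by (simp add: multi_index_def Q_def)
  have lt: "multi_index I N i < Q" unfolding Q_def using Suc.prems by (intro multi_index_less) auto
  show ?case
  proof (cases "n = N")
    case True
    have "(multi_index I N i + i N * Q) div Q = i N" using lt by simp
    with True Suc.prems show ?thesis unfolding multi_digit_def eq by (simp add: Q_def)
  next
    case False
    with Suc.prems have n: "n < N" by simp
    have "Q = (\<Prod>k<Suc n. I k) * (\<Prod>k=Suc n..<N. I k)"
      unfolding Q_def lessThan_atLeast0 using n by (intro prod.atLeastLessThan_concat[symmetric]) auto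
    then obtain c where Q: "Q = (\<Prod>k<n. I k) * (I n * c)" by (auto simp: mult.assoc)
    have pos: "(\<Prod>k<n. I k) > 0" using lt Q by (cases "(\<Prod>k<n. I k) = 0") auto
    have "multi_index I (Suc N) i div (\<Prod>k<n. I k)
        = (multi_index I N i + (\<Prod>k<n. I k) * (I n * (c * i N))) div (\<Prod>k<n. I k)"
      by (simp add: eq Q mult_ac)
    also have "\<dots> = multi_index I N i div (\<Prod>k<n. I k) + I n * (c * i N)"
      using pos by simp
    finally have "multi_digit I (multi_index I (Suc N) i) n = multi_digit I (multi_index I N i) n"
      by (simp add: multi_digit_def)
    with Suc n show ?thesis by simp
  qed
qed

section \<open>Hash maps and sketches\<close>

text \<open>A random map \<open>h\<close> from the keys \<open>{..<J}\<close> to the finite set \<open>V\<close> on the probability space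
  \<open>M\<close>; \<open>h \<omega>\<close> is its realization. The values are not required to be uniformly distributed, and
  nothing is required of more or fewer than \<open>k\<close> keys.\<close>

definition kwise_indep_hash ::
    "'w measure \<Rightarrow> nat \<Rightarrow> nat \<Rightarrow> 'v set \<Rightarrow> ('w \<Rightarrow> nat \<Rightarrow> 'v) \<Rightarrow> bool" where
  "kwise_indep_hash M k J V h \<longleftrightarrow>
     (\<forall>i<J. (\<lambda>\<omega>. h \<omega> i) \<in> measurable M (count_space V)) \<and>
     (\<forall>K \<subseteq> {..<J}. card K = k \<longrightarrow>
        prob_space.indep_vars M (\<lambda>_. count_space V) (\<lambda>i \<omega>. h \<omega> i) K)"

definition hash_mat :: "nat \<Rightarrow> nat \<Rightarrow> (nat \<Rightarrow> nat) \<Rightarrow> real mat" where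
  "hash_mat m J h = Matrix.mat m J (\<lambda>(j, i). if j = h i then 1 else 0)"

definition count_sketch :: "nat \<Rightarrow> nat \<Rightarrow> (nat \<Rightarrow> nat) \<Rightarrow> (nat \<Rightarrow> real) \<Rightarrow> real mat" where
  "count_sketch m J h s = hash_mat m J h * mat_diag J s"

definition combined_hash :: "nat \<Rightarrow> nat \<Rightarrow> (nat \<Rightarrow> nat \<Rightarrow> nat) \<Rightarrow> (nat \<Rightarrow> nat) \<Rightarrow> nat" where
  "combined_hash m N h i = (\<Sum>n<N. h n (i n)) mod m"

definition combined_sign :: "nat \<Rightarrow> (nat \<Rightarrow> nat \<Rightarrow> real) \<Rightarrow> (nat \<Rightarrow> nat) \<Rightarrow> real" where
  "combined_sign N s i = (\<Prod>n<N. s n (i n))"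

definition tensor_sketch ::
    "nat \<Rightarrow> nat \<Rightarrow> (nat \<Rightarrow> nat) \<Rightarrow> (nat \<Rightarrow> nat \<Rightarrow> nat) \<Rightarrow> (nat \<Rightarrow> nat \<Rightarrow> real) \<Rightarrow> real mat" where
  "tensor_sketch m N I h s =
     hash_mat m (\<Prod>n<N. I n) (\<lambda>l. combined_hash m N h (multi_digit I l)) *
     mat_diag (\<Prod>n<N. I n) (\<lambda>l. combined_sign N s (multi_digit I l))"

section \<open>Fourier transform along the second mode\<close>

definition fft2 :: "complex tensor3 \<Rightarrow> complex tensor3" where
  "fft2 X = tensor3 (dim1 X) (dim2 X) (dim3 X)
     (\<lambda>p k q. \<Sum>j<dim2 X. entry X p j q *
        exp (- 2 * of_real pi * \<i> * of_nat j * of_nat k / of_nat (dim2 X)))"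

text \<open>A genuine two-sided inverse, by \<open>bij_fft2\<close>; it preserves sizes because \<^const>\<open>fft2\<close> does.\<close>

definition ifft2 :: "complex tensor3 \<Rightarrow> complex tensor3" where
  "ifft2 = inv_into UNIV fft2"

lemma dft_orthogonality:
  fixes a b m :: nat
  assumes "a < m" "b < m"
  shows "(\<Sum>k<m. exp (2 * of_real pi * \<i> * of_nat k * (of_nat a - of_nat b) / of_nat m))
       = (if a = b then of_nat m else (0::complex))"
proof (cases "a = b")
  case False
  define z :: complex where "z = exp (2 * of_real pi * \<i> * (of_nat a - of_nat b) / of_nat m)"
  have m: "m > 0" using assms by simp
  have pow: "exp (2 * of_real pi * \<i> * of_nat k * (of_nat a - of_nat b) / of_nat m) = z ^ k" for k
    by (simp add: z_def exp_of_nat_mult[symmetric] field_simps)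
  have "z ^ m = exp (2 * of_real pi * \<i> * of_int (int a - int b))"
    using m by (simp add: z_def exp_of_nat_mult[symmetric])
  also have "\<dots> = 1" by (subst exp_eq_1) (auto intro: exI[of _ "int a - int b"])
  finally have zm: "z ^ m = 1" .
  have "z \<noteq> 1"
  proof
    assume "z = 1"
    then obtain n :: int where n: "2 * pi * (real a - real b) / real m = of_int (2 * n) * pi"
      unfolding z_def exp_eq_1 by auto
    hence "(2 * pi) * (real a - real b) = (2 * pi) * (of_int n * real m)"
      using m by (simp add: field_simps)
    hence "real a - real b = of_int n * real m" by (subst (asm) mult_cancel_left) simp
    hence "real_of_int (int a - int b) = real_of_int (n * int m)" by simp
    hence eq: "int a - int b = n * int m" by (simp only: of_int_eq_iff)
    hence "\<bar>n * int m\<bar> < int m" using assms by linarith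
    hence "\<bar>n\<bar> * int m < 1 * int m" by (simp add: abs_mult)
    hence "n = 0" using m by (simp add: mult_less_cancel_right)
    with eq False show False by simp
  qed
  thus ?thesis using False by (simp add: pow geometric_sum zm)
qed simp

lemma bij_fft2: "bij fft2"
proof -
  define G where "G X = tensor3 (dim1 X) (dim2 X) (dim3 X)
     (\<lambda>p j q. (\<Sum>k<dim2 X. entry X p k q *
        exp (2 * of_real pi * \<i> * of_nat j * of_nat k / of_nat (dim2 X))) / of_nat (dim2 X))"
    for X :: "complex tensor3"
  have GF: "G (fft2 X) = X" for X
  proof (rule tensor3_eqI)
    fix p j q assume b: "p < dim1 X" "j < dim2 X" "q < dim3 X"
    let ?m = "dim2 X"
    have "(\<Sum>k<?m. (\<Sum>i<?m. entry X p i q * exp (- 2 * of_real pi * \<i> * of_nat i * of_nat k / of_nat ?m)) *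
             exp (2 * of_real pi * \<i> * of_nat j * of_nat k / of_nat ?m))
        = (\<Sum>k<?m. \<Sum>i<?m. entry X p i q *
             exp (2 * of_real pi * \<i> * of_nat k * (of_nat j - of_nat i) / of_nat ?m))"
      unfolding sum_distrib_right mult.assoc
      by (intro sum.cong refl arg_cong2[where f="(*)"])
         (simp add: exp_add[symmetric] field_simps)
    also have "\<dots> = (\<Sum>i<?m. entry X p i q *
        (\<Sum>k<?m. exp (2 * of_real pi * \<i> * of_nat k * (of_nat j - of_nat i) / of_nat ?m)))"
      by (subst sum.swap) (simp add: sum_distrib_left)
    also have "\<dots> = (\<Sum>i<?m. entry X p i q * (if j = i then of_nat ?m else 0))"
      using b by (intro sum.cong refl, subst dft_orthogonality) auto
    also have "\<dots> = entry X p j q * of_nat ?m"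
      using b by (simp add: if_distrib cong: if_cong)
    finally show "entry (G (fft2 X)) p j q = entry X p j q"
      using b by (simp add: G_def fft2_def)
  qed (simp_all add: G_def fft2_def)
  have FG: "fft2 (G X) = X" for X
  proof (rule tensor3_eqI)
    fix p j q assume b: "p < dim1 X" "j < dim2 X" "q < dim3 X"
    let ?m = "dim2 X"
    have "(\<Sum>k<?m. (\<Sum>i<?m. entry X p i q * exp (2 * of_real pi * \<i> * of_nat k * of_nat i / of_nat ?m)) *
             exp (- 2 * of_real pi * \<i> * of_nat k * of_nat j / of_nat ?m))
        = (\<Sum>k<?m. \<Sum>i<?m. entry X p i q *
             exp (2 * of_real pi * \<i> * of_nat k * (of_nat i - of_nat j) / of_nat ?m))"
      unfolding sum_distrib_right mult.assoc
      by (intro sum.cong refl arg_cong2[where f="(*)"])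
         (simp add: exp_add[symmetric] field_simps)
    also have "\<dots> = (\<Sum>i<?m. entry X p i q *
        (\<Sum>k<?m. exp (2 * of_real pi * \<i> * of_nat k * (of_nat i - of_nat j) / of_nat ?m)))"
      by (subst sum.swap) (simp add: sum_distrib_left)
    also have "\<dots> = (\<Sum>i<?m. entry X p i q * (if i = j then of_nat ?m else 0))"
      using b by (intro sum.cong refl, subst dft_orthogonality) auto
    also have "\<dots> = entry X p j q * of_nat ?m"
      using b by (simp add: if_distrib cong: if_cong)
    finally show "entry (fft2 (G X)) p j q = entry X p j q"
      using b by (simp add: G_def fft2_def sum_divide_distrib[symmetric])
  qed (simp_all add: G_def fft2_def)
  show ?thesis by (rule o_bij[of G]) (auto simp: fun_eq_iff GF FG)
qed

end

theory Submission
  imports Defs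
begin

text \<open>
  In the Fourier domain the entry \<open>1\<close> of a sketching matrix in row \<open>h i\<close> becomes the power \<open>z ^ h i\<close>
  of an \<open>m\<close>-th root of unity \<open>z\<close>, so the reduction modulo \<open>m\<close> in the combined hash disappears and
  the weight \<open>s i * z ^ h i\<close> of a multi-index is the product of the weights of its components.
  A sum over multi-indices then factorises into a matrix product of sums over the components.
\<close>

section \<open>Roots of unity in the Fourier kernel\<close>

definition dft_root :: "nat \<Rightarrow> nat \<Rightarrow> complex" where
  "dft_root m k = exp (- 2 * of_real pi * \<i> * of_nat k / of_nat m)"

lemma dft_root_power:
  "dft_root m k ^ j = exp (- 2 * of_real pi * \<i> * of_nat j * of_nat k / of_nat m)"
  by (simp add: dft_root_def exp_of_nat_mult[symmetric] mult_ac)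

lemma dft_root_power_self: "dft_root m k ^ m = 1"
proof (cases "m = 0")
  case False
  then have "dft_root m k ^ m = exp (2 * of_real pi * \<i> * of_int (- int k))"
    by (simp add: dft_root_power mult_ac)
  also have "\<dots> = 1" by (subst exp_eq_1) (auto intro: exI[of _ "- int k"])
  finally show ?thesis .
qed simp

lemma dft_root_power_mod: "dft_root m k ^ (t mod m) = dft_root m k ^ t"
proof -
  have "dft_root m k ^ t = dft_root m k ^ (m * (t div m) + t mod m)" by simp
  also have "\<dots> = dft_root m k ^ (t mod m)"
    by (simp only: power_add power_mult dft_root_power_self power_one mult_1_left)
  finally show ?thesis ..
qed

section \<open>Sketching matrices and sketched tensors in the Fourier domain\<close>

lemma count_sketch_eq:
  "count_sketch m J h s = Matrix.mat m J (\<lambda>(j, i). if j = h i then s i else 0)"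
proof -
  have "hash_mat m J h \<in> carrier_mat m J" by (simp add: hash_mat_def)
  then show ?thesis
    unfolding count_sketch_def by (subst mat_diag_mult_right) (auto simp: hash_mat_def)
qed

text \<open>Needed because digit formulas such as \<open>multi_digit_top\<close> hold only for keys
  inside the index range.\<close>

lemma count_sketch_cong:
  assumes "\<And>i. i < J \<Longrightarrow> h i = h' i" "\<And>i. i < J \<Longrightarrow> s i = s' i"
  shows "count_sketch m J h s = count_sketch m J h' s'"
  using assms by (auto simp: count_sketch_eq intro!: eq_matI)

lemma tensor_sketch_eq_count_sketch:
  "tensor_sketch m N I h s = count_sketch m (\<Prod>n<N. I n)
     (\<lambda>l. combined_hash m N h (multi_digit I l)) (\<lambda>l. combined_sign N s (multi_digit I l))"
  by (simp add: tensor_sketch_def count_sketch_def)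

text \<open>The number of keys is read off the tensor, so the sizes match by construction. Being an
  abbreviation, it stays transparent to the size rules of the simplifier.\<close>

abbreviation fft_sketch ::
    "nat \<Rightarrow> (nat \<Rightarrow> nat) \<Rightarrow> (nat \<Rightarrow> real) \<Rightarrow> real tensor3 \<Rightarrow> complex tensor3" where
  "fft_sketch m h s X \<equiv> fft2 (map_tensor3 complex_of_real (X \<times>\<^sub>2 count_sketch m (dim2 X) h s))"

lemma dim_fft2 [simp]:
  "dim1 (fft2 X) = dim1 X" "dim2 (fft2 X) = dim2 X" "dim3 (fft2 X) = dim3 X"
  by (simp_all add: fft2_def)

lemma dim_map_tensor3 [simp]:
  "dim1 (map_tensor3 g X) = dim1 X"
  "dim2 (map_tensor3 g X) = dim2 X"
  "dim3 (map_tensor3 g X) = dim3 X"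
  by (simp_all add: map_tensor3_def)

lemma dim_mode2_prod [simp]:
  "dim1 (X \<times>\<^sub>2 U) = dim1 X" "dim2 (X \<times>\<^sub>2 U) = dim_row U" "dim3 (X \<times>\<^sub>2 U) = dim3 X"
  by (simp_all add: mode2_prod_def)

lemma dim_row_count_sketch [simp]: "dim_row (count_sketch m J h s) = m"
  by (simp add: count_sketch_eq)

text \<open>Column \<open>i\<close> of the sketch has its only possible nonzero entry,
  \<open>s i\<close>, in row \<open>h i\<close>. The sum over rows therefore collapses to the kernel
  value \<open>dft_root m k ^ h i\<close>.\<close>

lemma entry_fft_sketch:
  assumes "p < dim1 X" "k < m" "q < dim3 X" and h: "\<And>i. i < dim2 X \<Longrightarrow> h i < m"
  shows "entry (fft_sketch m h s X) p k q =
    (\<Sum>i<dim2 X. of_real (entry X p i q) * (of_real (s i) * dft_root m k ^ h i))"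
proof -
  have "entry (fft_sketch m h s X) p k q =
      (\<Sum>j<m. of_real (\<Sum>i<dim2 X. entry X p i q * (if j = h i then s i else 0)) * dft_root m k ^ j)"
    using assms by (simp add: fft2_def map_tensor3_def mode2_prod_def count_sketch_eq dft_root_power)
  also have "\<dots> = (\<Sum>i<dim2 X. \<Sum>j<m.
      if j = h i then of_real (entry X p i q) * (of_real (s i) * dft_root m k ^ h i) else 0)"
    by (subst sum.swap) (auto simp: sum_distrib_right intro!: sum.cong)
  also have "\<dots> = (\<Sum>i<dim2 X. of_real (entry X p i q) * (of_real (s i) * dft_root m k ^ h i))"
    \<comment> \<open>The bound on \<open>h\<close> places the row \<open>h i\<close> inside the
      range of \<open>j\<close>.\<close>
    using h by (intro sum.cong) auto
  finally show ?thesis .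
qed

section \<open>Tensor products and the case of two factors\<close>

lemma dim_subchain_prod [simp]:
  "dim1 (A \<boxtimes>\<^sub>2 B) = dim1 A" "dim2 (A \<boxtimes>\<^sub>2 B) = dim2 A * dim2 B" "dim3 (A \<boxtimes>\<^sub>2 B) = dim3 B"
  by (simp_all add: subchain_prod_def tensor_of_slices_def)

lemma dim_slices_hadamard_prod [simp]:
  "dim1 (X \<circledast>\<^sub>2 Y) = dim1 X" "dim2 (X \<circledast>\<^sub>2 Y) = dim2 X" "dim3 (X \<circledast>\<^sub>2 Y) = dim3 Y"
  by (simp_all add: slices_hadamard_prod_def tensor_of_slices_def)

lemma entry_subchain_prod:
  assumes "dim3 A = dim1 B" "p < dim1 A" "i < dim2 A" "j < dim2 B" "q < dim3 B"
  shows "entry (A \<boxtimes>\<^sub>2 B) p (i + j * dim2 A) q = (\<Sum>r<dim1 B. entry A p i r * entry B r j q)"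
proof -
  have lt: "i + j * dim2 A < dim2 A * dim2 B"
  proof -
    have "i + j * dim2 A < Suc j * dim2 A" using assms by simp
    also have "\<dots> \<le> dim2 B * dim2 A" using assms by (intro mult_right_mono) auto
    finally show ?thesis by (simp add: mult.commute)
  qed
  have "entry (A \<boxtimes>\<^sub>2 B) p (i + j * dim2 A) q = lateral_slice (A \<boxtimes>\<^sub>2 B) (i + j * dim2 A) $$ (p, q)"
    using assms by (simp add: lateral_slice_def)
  also have "\<dots> = (lateral_slice A i * lateral_slice B j) $$ (p, q)"
    using assms by (subst lateral_slice_subchain_prod) simp_all
  also have "\<dots> = (\<Sum>r<dim1 B. entry A p i r * entry B r j q)"
    using assms by (simp add: lateral_slice_def scalar_prod_def lessThan_atLeast0)
  finally show ?thesis .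
qed

lemma entry_slices_hadamard_prod:
  assumes "dim3 X = dim1 Y" "p < dim1 X" "j < dim2 X" "q < dim3 Y"
  shows "entry (X \<circledast>\<^sub>2 Y) p j q = (\<Sum>r<dim1 Y. entry X p j r * entry Y r j q)"
  using assms
  by (simp add: slices_hadamard_prod_def tensor_of_slices_def lateral_slice_def scalar_prod_def
      lessThan_atLeast0)

text \<open>The range is cut into \<open>b\<close> blocks of length \<open>a\<close>;
  \<open>i\<close> is the offset within a block, which matches the little-endian slices of
  \<open>subchain_prod\<close>.\<close>

lemma sum_lessThan_times_split:
  fixes f :: "nat \<Rightarrow> 'a::comm_monoid_add"
  shows "(\<Sum>l<a * b. f l) = (\<Sum>i<a. \<Sum>j<b. f (i + j * a))"
proof -
  have "(\<Sum>l<a * b. f l) = (\<Sum>j<b. \<Sum>i<a. f (i + j * a))"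
    using sum.nat_group[of f a b]
    by (simp add: mult.commute sum.atLeastLessThan_shift_0[of f "_ * a"] lessThan_atLeast0 add.commute)
  then show ?thesis by (subst sum.swap)
qed

text \<open>A convolution theorem for slices: the weight of a pair of keys is the product of the two
  weights, so for each contraction index \<open>r\<close> the sum over pairs is a product of two
  sums, as in a matrix product.\<close>

lemma fft_sketch_subchain_prod:
  assumes AB: "dim3 A = dim1 B"
    and hA: "\<And>i. i < dim2 A \<Longrightarrow> hA i < m" and hB: "\<And>j. j < dim2 B \<Longrightarrow> hB j < m"
  shows "fft_sketch m (\<lambda>l. (hA (l mod dim2 A) + hB (l div dim2 A)) mod m)
      (\<lambda>l. sA (l mod dim2 A) * sB (l div dim2 A)) (A \<boxtimes>\<^sub>2 B) =
    fft_sketch m hA sA A \<circledast>\<^sub>2 fft_sketch m hB sB B"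
    (is "fft_sketch m ?h ?s _ = ?X \<circledast>\<^sub>2 ?Y")
proof (rule tensor3_eqI)
  fix p k q assume "p < dim1 (?X \<circledast>\<^sub>2 ?Y)" "k < dim2 (?X \<circledast>\<^sub>2 ?Y)" "q < dim3 (?X \<circledast>\<^sub>2 ?Y)"
  then have b: "p < dim1 A" "k < m" "q < dim3 B" by simp_all
  let ?wA = "\<lambda>i. of_real (sA i) * dft_root m k ^ hA i"
  let ?wB = "\<lambda>j. of_real (sB j) * dft_root m k ^ hB j"
  have "entry (fft_sketch m ?h ?s (A \<boxtimes>\<^sub>2 B)) p k q = (\<Sum>l<dim2 A * dim2 B.
      of_real (entry (A \<boxtimes>\<^sub>2 B) p l q) * (of_real (?s l) * dft_root m k ^ ?h l))"
    \<comment> \<open>The combined hash is below \<open>m\<close> since \<open>k < m\<close> forces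
      \<open>m > 0\<close>.\<close>
    using b by (subst entry_fft_sketch) simp_all
  also have "\<dots> = (\<Sum>i<dim2 A. \<Sum>j<dim2 B. \<Sum>r<dim1 B.
      (of_real (entry A p i r) * ?wA i) * (of_real (entry B r j q) * ?wB j))"
    unfolding sum_lessThan_times_split
  proof (intro sum.cong refl)
    fix i j assume "i \<in> {..<dim2 A}" "j \<in> {..<dim2 B}"
    then have "entry (A \<boxtimes>\<^sub>2 B) p (i + j * dim2 A) q = (\<Sum>r<dim1 B. entry A p i r * entry B r j q)"
      and "(i + j * dim2 A) mod dim2 A = i" "(i + j * dim2 A) div dim2 A = j"
      using AB b by (simp_all add: entry_subchain_prod)
    then show "of_real (entry (A \<boxtimes>\<^sub>2 B) p (i + j * dim2 A) q) *
        (of_real (?s (i + j * dim2 A)) * dft_root m k ^ ?h (i + j * dim2 A)) =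
      (\<Sum>r<dim1 B. (of_real (entry A p i r) * ?wA i) * (of_real (entry B r j q) * ?wB j))"
      by (simp add: dft_root_power_mod power_add sum_distrib_left sum_distrib_right mult_ac)
  qed
  \<comment> \<open>Two exchanges move \<open>r\<close> outermost, after which the sums over
    \<open>i\<close> and \<open>j\<close> separate by \<open>sum_product\<close>.\<close>
  also have "\<dots> = (\<Sum>i<dim2 A. \<Sum>r<dim1 B. \<Sum>j<dim2 B.
      (of_real (entry A p i r) * ?wA i) * (of_real (entry B r j q) * ?wB j))"
    by (intro sum.cong refl sum.swap)
  also have "\<dots> = (\<Sum>r<dim1 B. \<Sum>i<dim2 A. \<Sum>j<dim2 B.
      (of_real (entry A p i r) * ?wA i) * (of_real (entry B r j q) * ?wB j))"
    by (rule sum.swap)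
  also have "\<dots> = (\<Sum>r<dim1 B. entry ?X p k r * entry ?Y r k q)"
    using AB b hA hB by (intro sum.cong refl) (simp add: entry_fft_sketch sum_product)
  also have "\<dots> = entry (?X \<circledast>\<^sub>2 ?Y) p k q"
    using AB b by (simp add: entry_slices_hadamard_prod)
  finally show "entry (fft_sketch m ?h ?s (A \<boxtimes>\<^sub>2 B)) p k q = entry (?X \<circledast>\<^sub>2 ?Y) p k q" .
qed simp_all

section \<open>Digits of multi-indices and chains of factors\<close>

lemma chain_prod_1 [simp]: "chain_prod f X (Suc 0) = X 0"
  by (simp add: chain_prod_def)

lemma chain_prod_Suc [simp]:
  "N > 0 \<Longrightarrow> chain_prod f X (Suc N) = f (chain_prod f X N) (X N)"
  by (simp add: chain_prod_def)

text \<open>The reduction subtracts a multiple of the product of \<open>I 0\<close> to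
  \<open>I n\<close>, which changes the quotient in \<open>multi_digit\<close> by a multiple of
  \<open>I n\<close>.\<close>

lemma multi_digit_mod_prod:
  assumes "n < N"
  shows "multi_digit I (l mod (\<Prod>k<N. I k)) n = multi_digit I l n"
proof -
  have "(\<Prod>k<N. I k) = (\<Prod>k<Suc n. I k) * (\<Prod>k=Suc n..<N. I k)"
    unfolding lessThan_atLeast0
    using assms by (intro prod.atLeastLessThan_concat[symmetric]) auto
  then obtain c where "(\<Prod>k<N. I k) = (\<Prod>k<n. I k) * (I n * c)" by (auto simp: mult.assoc)
  moreover have "l mod (P * (J * c)) div P mod J = l div P mod J" for P J c :: nat
    \<comment> \<open>For \<open>P = 0\<close> both quotients are \<open>0\<close> by the convention
      for division by zero.\<close>
    by (cases "P = 0") (simp_all add: mod_mult2_eq mod_mod_cancel)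
  ultimately show ?thesis by (simp add: multi_digit_def)
qed

lemma multi_digit_top:
  assumes "l < (\<Prod>k<Suc N. I k)"
  shows "multi_digit I l N = l div (\<Prod>k<N. I k)"
  using assms by (simp add: multi_digit_def less_mult_imp_div_less mult.commute)

lemma combined_hash_cong:
  assumes "\<And>n. n < N \<Longrightarrow> i n = i' n"
  shows "combined_hash m N h i = combined_hash m N h i'"
  using assms by (simp add: combined_hash_def)

lemma combined_sign_cong:
  assumes "\<And>n. n < N \<Longrightarrow> i n = i' n"
  shows "combined_sign N s i = combined_sign N s i'"
  using assms by (simp add: combined_sign_def)

lemma combined_hash_Suc:
  "combined_hash m (Suc N) h i = (combined_hash m N h i + h N (i N)) mod m"
  by (simp add: combined_hash_def mod_add_left_eq)

lemma combined_sign_Suc: "combined_sign (Suc N) s i = combined_sign N s i * s N (i N)"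
  by (simp add: combined_sign_def)

text \<open>Splitting off the leading digit gives the hash and sign the form of
  \<open>fft_sketch_subchain_prod\<close>, with the first \<open>N\<close> factors merged into one
  factor with \<open>J\<close> keys.\<close>

lemma tensor_sketch_Suc:
  fixes I :: "nat \<Rightarrow> nat" and N :: nat
  defines "J \<equiv> \<Prod>n<N. I n"
  shows "tensor_sketch m (Suc N) I h s = count_sketch m (J * I N)
     (\<lambda>l. (combined_hash m N h (multi_digit I (l mod J)) + h N (l div J)) mod m)
     (\<lambda>l. combined_sign N s (multi_digit I (l mod J)) * s N (l div J))"
proof -
  have top: "multi_digit I l N = l div J" if "l < J * I N" for l
    using multi_digit_top[of l I N] that by (simp add: J_def)
  have low: "combined_hash m N h (multi_digit I (l mod J)) = combined_hash m N h (multi_digit I l)"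
    "combined_sign N s (multi_digit I (l mod J)) = combined_sign N s (multi_digit I l)" for l
    unfolding J_def
    by (auto intro!: combined_hash_cong combined_sign_cong simp: multi_digit_mod_prod)
  have "tensor_sketch m (Suc N) I h s = count_sketch m (J * I N)
     (\<lambda>l. combined_hash m (Suc N) h (multi_digit I l))
     (\<lambda>l. combined_sign (Suc N) s (multi_digit I l))"
    by (simp add: tensor_sketch_eq_count_sketch J_def)
  also have "\<dots> = count_sketch m (J * I N)
     (\<lambda>l. (combined_hash m N h (multi_digit I (l mod J)) + h N (l div J)) mod m)
     (\<lambda>l. combined_sign N s (multi_digit I (l mod J)) * s N (l div J))"
    \<comment> \<open>The congruence rule provides the bound on \<open>l\<close> that
      \<open>top\<close> requires.\<close>
    by (rule count_sketch_cong) (simp_all add: combined_hash_Suc combined_sign_Suc top low)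
  finally show ?thesis .
qed

text \<open>With one factor, the reductions modulo \<open>m\<close> and modulo \<open>I 0\<close>
  leave the values unchanged.\<close>

lemma tensor_sketch_1:
  assumes "\<And>i. i < I 0 \<Longrightarrow> h 0 i < m"
  shows "tensor_sketch m (Suc 0) I h s = count_sketch m (I 0) (h 0) (s 0)"
  unfolding tensor_sketch_eq_count_sketch using assms
  by (auto intro!: count_sketch_cong
      simp: combined_hash_def combined_sign_def multi_digit_def)

lemma chain_subchain_prod_carrier:
  assumes "N > 0" "\<And>n. n < N \<Longrightarrow> A n \<in> carrier_tensor3 (R n) (I n) (R (Suc n))"
  shows "chain_prod (\<boxtimes>\<^sub>2) A N \<in> carrier_tensor3 (R 0) (\<Prod>n<N. I n) (R N)"
  using assms
  by (induction N rule: nat_induct_non_zero) (simp_all add: carrier_tensor3_def)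

text \<open>Induction on the number of factors, splitting off the last one as
  \<open>chain_prod\<close> does. Staying in the Fourier domain keeps the inverse transform out of
  the induction.\<close>

lemma fft2_tensor_sketch_chain:
  assumes "N > 0" "m > 0"
    and "\<And>n. n < N \<Longrightarrow> A n \<in> carrier_tensor3 (R n) (I n) (R (Suc n))"
    and "\<And>n i. n < N \<Longrightarrow> i < I n \<Longrightarrow> h n i < m"
  shows "fft2 (map_tensor3 complex_of_real (chain_prod (\<boxtimes>\<^sub>2) A N \<times>\<^sub>2 tensor_sketch m N I h s)) =
    chain_prod (\<circledast>\<^sub>2)
      (\<lambda>n. fft2 (map_tensor3 complex_of_real (A n \<times>\<^sub>2 count_sketch m (I n) (h n) (s n)))) N"
  using assms
proof (induction N rule: nat_induct_non_zero)
  case 1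
  then show ?case by (simp add: tensor_sketch_1)
next
  case (Suc N)
  let ?P = "chain_prod (\<boxtimes>\<^sub>2) A N" and ?J = "\<Prod>n<N. I n"
  have P: "dim2 ?P = ?J" "dim3 ?P = R N"
    using chain_subchain_prod_carrier[of N A R I] Suc by (simp_all add: carrier_tensor3_def)
  have A: "dim1 (A N) = R N" "dim2 (A N) = I N"
    using Suc.prems(2)[of N] by (simp_all add: carrier_tensor3_def)
  have "fft2 (map_tensor3 complex_of_real (chain_prod (\<boxtimes>\<^sub>2) A (Suc N) \<times>\<^sub>2
      tensor_sketch m (Suc N) I h s)) =
    fft_sketch m (\<lambda>l. (combined_hash m N h (multi_digit I (l mod dim2 ?P)) + h N (l div dim2 ?P)) mod m)
      (\<lambda>l. combined_sign N s (multi_digit I (l mod dim2 ?P)) * s N (l div dim2 ?P)) (?P \<boxtimes>\<^sub>2 A N)"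
    using Suc.hyps by (simp add: tensor_sketch_Suc P A)
  also have "\<dots> = fft_sketch m (\<lambda>l. combined_hash m N h (multi_digit I l))
        (\<lambda>l. combined_sign N s (multi_digit I l)) ?P \<circledast>\<^sub>2 fft_sketch m (h N) (s N) (A N)"
    \<comment> \<open>The hash of the merged factor is below \<open>m\<close>, being a remainder
      modulo \<open>m > 0\<close>.\<close>
    using Suc.prems P A by (intro fft_sketch_subchain_prod) (simp_all add: combined_hash_def)
  also have "\<dots> = chain_prod (\<circledast>\<^sub>2)
      (\<lambda>n. fft2 (map_tensor3 complex_of_real (A n \<times>\<^sub>2 count_sketch m (I n) (h n) (s n)))) (Suc N)"
    using Suc by (simp add: P A tensor_sketch_eq_count_sketch[symmetric])
  finally show ?case .
qed

theorem proposition3p5: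
  fixes M :: "'w measure"
    and N m :: nat
    and I R :: "nat \<Rightarrow> nat"
    and H :: "nat \<Rightarrow> 'w \<Rightarrow> nat \<Rightarrow> nat"
    and S :: "nat \<Rightarrow> 'w \<Rightarrow> nat \<Rightarrow> real"
    and A :: "nat \<Rightarrow> real tensor3"
    and \<omega> :: 'w
  assumes "N > 0" and "m > 0"
    and "\<And>n. n < N \<Longrightarrow> I n > 0"
    and "\<And>n. n \<le> N \<Longrightarrow> R n > 0"
    and "prob_space M"
    and "\<And>n. n < N \<Longrightarrow> kwise_indep_hash M 3 (I n) {..<m} (H n)"
    and "\<And>n. n < N \<Longrightarrow> kwise_indep_hash M 4 (I n) {-1, 1} (S n)"
    and "\<And>n. n < N \<Longrightarrow> A n \<in> carrier_tensor3 (R n) (I n) (R (Suc n))"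
    and "\<omega> \<in> space M"
  shows "map_tensor3 complex_of_real
      (chain_prod (\<boxtimes>\<^sub>2) A N \<times>\<^sub>2
        tensor_sketch m N I (\<lambda>n. H n \<omega>) (\<lambda>n. S n \<omega>)) =
    ifft2 (chain_prod (\<circledast>\<^sub>2)
      (\<lambda>n. fft2 (map_tensor3 complex_of_real
        (A n \<times>\<^sub>2 count_sketch m (I n) (H n \<omega>) (S n \<omega>)))) N)"
proof -
  \<comment> \<open>Measurability into \<open>count_space {..<m}\<close> includes that every
    realization takes its values below \<open>m\<close>.\<close>
  have h: "H n \<omega> i < m" if "n < N" "i < I n" for n i
  proof -
    have "(\<lambda>\<omega>. H n \<omega> i) \<in> measurable M (count_space {..<m})"
      using assms(6)[OF that(1)] that(2) by (simp add: kwise_indep_hash_def)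
    from measurable_space[OF this assms(9)] show ?thesis by simp
  qed
  show ?thesis
    unfolding ifft2_def
    \<comment> \<open>Since \<open>fft2\<close> is injective, it suffices to compare both sides
      after applying \<open>fft2\<close>.\<close>
    by (rule inv_f_eq[symmetric, OF bij_is_inj[OF bij_fft2]], rule fft2_tensor_sketch_chain)
       (use assms h in auto)
qed

end
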